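(* Let $H$ be a real Hilbert space, $K\subset H$ a nonempty closed convex set, and let $f,g:K\times K\to\mathbb{R}$ be monotone, upper hemicontinuous equilibrium bifunctions satisfying the standing assumptions listed in the context (in particular the solution set $S$ of the bilevel equilibrium problem is nonempty). Let $\{\lambda_n\}_{n\ge 1}$ and $\{\beta_n\}_{n\ge 1}$ be sequences of positive reals, let $x_0,x_1\in K$, and let $\{x_n\}\subset K$ be a sequence such that for every $n\geq 1$, with $y_n:=x_n+\alpha(x_n-x_{n-1})$, $$\beta_n f(x_{n+1},y)+g(x_{n+1},y)+\frac{1}{\lambda_n}\langle x_{n+1}-y_n,\,y-x_{n+1}\rangle\geq 0\qquad\text{for all } y\in K.$$ Assume that for all $u\in S_f$ and all $p\in N_{S_f}(u)$, $$\sum_{n=1}^{+\infty}\lambda_n\beta_n\left[\mathcal{F}_f\left(u,\frac{2p}{\beta_n}\right)-\sigma_{S_f}\left(\frac{2p}{\beta_n}\right)\right]<+\infty,$$ and that $0\leq\alpha<\frac13$, $\liminf_{n\to+\infty}\lambda_n>0$ and $\lim_{n\to+\infty}\beta_n=+\infty$. Then the sequence $\{x_n\}$ converges weakly to some $\bar x\in S$.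
   Context: A bifunction $f:K\times K\to\mathbb{R}$ is: monotone if $f(x,y)+f(y,x)\leq 0$ for all $x,y\in K$; upper hemicontinuous if $\lim_{t\searrow 0}f(tz+(1-t)x,y)\leq f(x,y)$ for all $x,y,z\in K$; an equilibrium bifunction if for each $x\in K$, $f(x,x)=0$ and $f(x,\cdot)$ is convex and lower semicontinuous on $K$. $S_f:=\{u\in K: f(u,y)\geq 0\ \forall y\in K\}$. The bilevel equilibrium problem (BEP) is: find $\bar x\in S_f$ such that $g(\bar x,y)\geq 0$ for all $y\in S_f$; $S$ denotes its solution set. The Fitzpatrick transform of $f$ is $\mathcal{F}_f:K\times H\to\mathbb{R}\cup\{+\infty\}$, $\mathcal{F}_f(x,u)=\sup_{y\in K}\{\langle u,y\rangle+f(y,x)\}$. For $C\subset H$, $\sigma_C(x^* )=\sup_{y\in C}\langle x^*,y\rangle$ is the support function, and $N_C(x)=\{x^*\in H:\langle x^*,u-x\rangle\leq 0\ \forall u\in C\}$ if $x\in C$ (empty otherwise) is the normal cone. For $u\in K$, $g_u:H\to\mathbb{R}\cup\{+\infty\}$ is $g_u(x)=g(u,x)$ if $x\in K$ and $+\infty$ otherwise; $\partial$ is the convex subdifferential. Standing assumptions: $S\neq\emptyset$; for each $y\in K$, $\partial g_y(y)\neq\emptyset$; $K\cap S_f\neq\emptyset$ and $\mathbb{R}_+(K-S_f)$ is a closed linear subspace of $H$. *)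

theory Defs
  imports "HOL-Analysis.Analysis"
begin

text \<open>
  A function that the mathematics defines only on \<open>K\<close> (or on \<open>K \<times> K\<close>) is a total HOL function here. Its
  values elsewhere are irrelevant: in \<open>upper_hemicontinuous\<close> the point \<open>t z + (1 - t) x\<close> lies in the
  convex set \<open>K\<close> for small \<open>t > 0\<close>, and \<open>fitzpatrick_transform K f x\<close> is meant for \<open>x \<in> K\<close>.
\<close>

definition lower_semicontinuous_on :: "'a::topological_space set \<Rightarrow> ('a \<Rightarrow> real) \<Rightarrow> bool" where
  "lower_semicontinuous_on K h \<longleftrightarrow>
     (\<forall>x\<in>K. \<forall>c<h x. eventually (\<lambda>y. c < h y) (at x within K))"

definition monotone_bifunction :: "'a set \<Rightarrow> ('a \<Rightarrow> 'a \<Rightarrow> real) \<Rightarrow> bool" where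
  "monotone_bifunction K f \<longleftrightarrow> (\<forall>x\<in>K. \<forall>y\<in>K. f x y + f y x \<le> 0)"

text \<open>
  The limit as \<open>t\<close> decreases to \<open>0\<close> is the upper limit, which always exists in the extended reals
  and equals the limit whenever the latter exists.
\<close>

definition upper_hemicontinuous :: "'a::real_vector set \<Rightarrow> ('a \<Rightarrow> 'a \<Rightarrow> real) \<Rightarrow> bool" where
  "upper_hemicontinuous K f \<longleftrightarrow>
     (\<forall>x\<in>K. \<forall>y\<in>K. \<forall>z\<in>K.
        Limsup (at_right (0::real)) (\<lambda>t. ereal (f (t *\<^sub>R z + (1 - t) *\<^sub>R x) y)) \<le> ereal (f x y))"

definition equilibrium_bifunction :: "'a::real_normed_vector set \<Rightarrow> ('a \<Rightarrow> 'a \<Rightarrow> real) \<Rightarrow> bool" where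
  "equilibrium_bifunction K f \<longleftrightarrow>
     (\<forall>x\<in>K. f x x = 0 \<and> convex_on K (f x) \<and> lower_semicontinuous_on K (f x))"

definition equilibrium_solutions :: "'a set \<Rightarrow> ('a \<Rightarrow> 'a \<Rightarrow> real) \<Rightarrow> 'a set" where
  "equilibrium_solutions K f = {u \<in> K. \<forall>y\<in>K. f u y \<ge> 0}"

definition bilevel_solutions ::
    "'a set \<Rightarrow> ('a \<Rightarrow> 'a \<Rightarrow> real) \<Rightarrow> ('a \<Rightarrow> 'a \<Rightarrow> real) \<Rightarrow> 'a set" where
  "bilevel_solutions K f g =
     {x \<in> equilibrium_solutions K f. \<forall>y\<in>equilibrium_solutions K f. g x y \<ge> 0}"

definition fitzpatrick_transform ::
    "'a::real_inner set \<Rightarrow> ('a \<Rightarrow> 'a \<Rightarrow> real) \<Rightarrow> 'a \<Rightarrow> 'a \<Rightarrow> ereal" where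
  "fitzpatrick_transform K f x u = (SUP y\<in>K. ereal (inner u y + f y x))"

definition support_function :: "'a::real_inner set \<Rightarrow> 'a \<Rightarrow> ereal" where
  "support_function C p = (SUP y\<in>C. ereal (inner p y))"

definition normal_cone :: "'a::real_inner set \<Rightarrow> 'a \<Rightarrow> 'a set" where
  "normal_cone C x = (if x \<in> C then {p. \<forall>u\<in>C. inner p (u - x) \<le> 0} else {})"

definition extend_by_infinity :: "'a set \<Rightarrow> ('a \<Rightarrow> real) \<Rightarrow> 'a \<Rightarrow> ereal" where
  "extend_by_infinity K h x = (if x \<in> K then ereal (h x) else \<infinity>)"

definition subdifferential :: "('a::real_inner \<Rightarrow> ereal) \<Rightarrow> 'a \<Rightarrow> 'a set" where
  "subdifferential h x = {p. \<bar>h x\<bar> \<noteq> \<infinity> \<and> (\<forall>z. h x + ereal (inner p (z - x)) \<le> h z)}"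

definition weakly_converges_to :: "(nat \<Rightarrow> 'a::real_normed_vector) \<Rightarrow> 'a \<Rightarrow> bool" where
  "weakly_converges_to x l \<longleftrightarrow>
     (\<forall>\<phi> :: 'a \<Rightarrow> real. bounded_linear \<phi> \<longrightarrow> (\<lambda>n. \<phi> (x n)) \<longlonglongrightarrow> \<phi> l)"

text \<open>
  In \<open>penalty_series\<close> the series over \<open>n \<ge> 1\<close> is taken in the extended reals. For \<open>u\<close> in the solution
  set \<open>C\<close> and \<open>p\<close> in the normal cone of \<open>C\<close> at \<open>u\<close>, the support function is finite at \<open>2p/\<beta>\<^sub>n\<close>, with
  value \<open>\<langle>2p/\<beta>\<^sub>n, u\<rangle>\<close>, and it is bounded above by the Fitzpatrick transform because \<open>f v u \<ge> 0\<close> for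
  \<open>v \<in> C\<close>. So no difference \<open>\<infinity> - \<infinity>\<close> occurs, and all terms lie in \<open>[0, \<infinity>]\<close>.
\<close>

definition penalty_series ::
    "'a::real_inner set \<Rightarrow> ('a \<Rightarrow> 'a \<Rightarrow> real) \<Rightarrow> (nat \<Rightarrow> real) \<Rightarrow> (nat \<Rightarrow> real) \<Rightarrow> 'a \<Rightarrow> 'a \<Rightarrow> ereal" where
  "penalty_series K f lam bet u p =
     (\<Sum>k. let n = Suc k; q = (2 / bet n) *\<^sub>R p in
        ereal (lam n * bet n) *
          (fitzpatrick_transform K f u q - support_function (equilibrium_solutions K f) q))"

end

theory Submission
  imports Defs
begin

text \<open>
  Write \<open>C\<close> for the solution set of the lower-level problem. By Minty's lemma \<open>C\<close> consists of the
  \<open>z \<in> K\<close> with \<open>f y z \<le> 0\<close> for all \<open>y \<in> K\<close>, so it is closed and convex. A bilevel solution \<open>u\<close>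
  minimises the convex function \<open>g u\<close> over \<open>C\<close>.

  \<^bold>\<open>A multiplier.\<close> Because the cone generated by \<open>K - C\<close> is a closed subspace, the constraint qualification of
  Attouch and Brezis holds, and there is a vector \<open>p\<close> with \<open>g u k + \<langle>p, k - s\<rangle> \<ge> 0\<close> for all \<open>k \<in> K\<close> and
  \<open>s \<in> C\<close>; it lies in the normal cone of \<open>C\<close> at \<open>u\<close> (\<open>multiplier_exists\<close>). Three steps give it: the
  Baire category theorem yields the exact penalty bound \<open>g u k \<ge> - L \<parallel>k - s\<parallel>\<close>; projecting points
  \<open>(0, - \<epsilon>)\<close> onto the closed epigraph of the value function \<open>w \<mapsto> inf {g u k | k - s = w}\<close> turns this
  bound into multipliers of norm at most \<open>L\<close> that are exact up to \<open>\<epsilon>\<close>; and the sets of such multipliers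
  are nonempty, closed, bounded and convex and decrease with \<open>\<epsilon>\<close>, so in a Hilbert space they have a common point.

  \<^bold>\<open>An energy estimate.\<close> Testing the step that defines \<open>x\<^sub>n\<^sub>+\<^sub>1\<close> at \<open>u\<close> and using monotonicity of \<open>g\<close>
  and the multiplier, one is left with \<open>\<beta>\<^sub>n f(x\<^sub>n\<^sub>+\<^sub>1, u) + \<langle>p, x\<^sub>n\<^sub>+\<^sub>1 - u\<rangle>\<close>. Since \<open>f(x\<^sub>n\<^sub>+\<^sub>1, u) \<le> 0\<close>, half
  of the first summand may be discarded, and twice the rest is exactly what the Fitzpatrick transform at \<open>2p/\<beta>\<^sub>n\<close>
  controls. So the squared distances to \<open>u\<close> satisfy an inertial recursion with a summable error, and
  \<open>\<alpha> < 1/3\<close> makes the coefficient of the squared increments negative: \<open>\<parallel>x\<^sub>n - u\<parallel>\<close> converges and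
  the increments tend to \<open>0\<close> (\<open>inertial_recursion\<close>).

  \<^bold>\<open>Identification of the limit.\<close> A subgradient of \<open>g y\<close> at \<open>y\<close> bounds
  \<open>g(x\<^sub>n, y)\<close> from above, so dividing the step by \<open>\<beta>\<^sub>n \<rightarrow> \<infinity>\<close> gives \<open>limsup f(y, x\<^sub>n) \<le> 0\<close> for \<open>y \<in> K\<close>;
  for \<open>y \<in> C\<close> the \<open>f\<close>-term may be dropped and \<open>limsup g(y, x\<^sub>n) \<le> 0\<close>. These bounds hold along the whole
  sequence, so they pass to every point common to the closed convex hulls of the tails, and by Minty's lemma every
  such point is a bilevel solution. An Opial argument carried out with these hulls in place of weak cluster points
  (\<open>weak_convergence_from_tail_hulls\<close>) shows that there is exactly one, and that it is the weak limit.
\<close>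

section \<open>Convex sets in Hilbert spaces\<close>

text \<open>
  This replaces weak compactness throughout. Points of almost minimal norm in the sets form a Cauchy
  sequence: by the parallelogram law two of them are close, because the norm of their midpoint is bounded
  below by the minimal norm, and the minimal norms increase to a finite limit.
\<close>

lemma decreasing_convex_sets_meet:
  fixes A :: "nat \<Rightarrow> 'a::{real_inner, complete_space} set"
  assumes closed: "\<And>n. closed (A n)" and convex: "\<And>n. convex (A n)"
    and nonempty: "\<And>n. A n \<noteq> {}" and dec: "\<And>m n. m \<le> n \<Longrightarrow> A n \<subseteq> A m"
    and bdd: "bounded (A 0)"
  shows "\<exists>z. \<forall>n. z \<in> A n"
proof -
  obtain B where B: "\<And>z. z \<in> A 0 \<Longrightarrow> norm z \<le> B"
    using bdd by (auto simp: bounded_iff)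
  define d where "d n = Inf ((\<lambda>z. (norm z)\<^sup>2) ` A n)" for n
  have bb: "bdd_below ((\<lambda>z. (norm z)\<^sup>2) ` A n)" for n
    by (rule bdd_belowI[of _ 0]) auto
  have d_le: "d n \<le> (norm z)\<^sup>2" if "z \<in> A n" for n z
    unfolding d_def by (rule cInf_lower[OF imageI[OF that] bb])
  have d_mono: "d m \<le> d n" if "m \<le> n" for m n
    unfolding d_def using dec[OF that] nonempty bb by (intro cInf_superset_mono) auto
  have "d n \<le> B\<^sup>2" for n
  proof -
    obtain z where z: "z \<in> A n" using nonempty by auto
    then have "norm z \<le> B" using B dec[of 0 n] by auto
    then have "(norm z)\<^sup>2 \<le> B\<^sup>2" by (simp add: power_mono)
    then show ?thesis using d_le[OF z] by linarith
  qed
  then have "convergent d"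
    using d_mono incseq_convergent[of d "B\<^sup>2"] by (metis convergent_def incseq_def)
  then have Cauchy_d: "Cauchy d" by (rule convergent_Cauchy)
  have "\<forall>n. \<exists>z. z \<in> A n \<and> (norm z)\<^sup>2 < d n + 1 / real (Suc n)"
  proof
    fix n
    have "Inf ((\<lambda>z. (norm z)\<^sup>2) ` A n) < d n + 1 / real (Suc n)" unfolding d_def by simp
    then show "\<exists>z. z \<in> A n \<and> (norm z)\<^sup>2 < d n + 1 / real (Suc n)"
      using bb[of n] nonempty[of n] by (subst (asm) cInf_less_iff) auto
  qed
  from choice[OF this]
  obtain a where a: "\<And>n. a n \<in> A n" "\<And>n. (norm (a n))\<^sup>2 < d n + 1 / real (Suc n)"
    by blast
  have near: "(norm (a n - a m))\<^sup>2 \<le> 2 * (d m - d n) + 4 / real (Suc n)" if "n \<le> m" for n m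
  proof -
    have am: "a m \<in> A n" by (rule subsetD[OF dec[OF that] a(1)])
    have "(1/2) *\<^sub>R a n + (1/2) *\<^sub>R a m \<in> A n"
      using convex[of n] a(1)[of n] am by (simp add: convex_def)
    then have "d n \<le> (norm ((1/2) *\<^sub>R a n + (1/2) *\<^sub>R a m))\<^sup>2" by (rule d_le)
    also have "\<dots> = (norm (a n + a m))\<^sup>2 / 4"
      by (simp add: power2_norm_eq_inner algebra_simps inner_commute)
    finally have "4 * d n \<le> (norm (a n + a m))\<^sup>2" by simp
    moreover have "(norm (a n + a m))\<^sup>2 + (norm (a n - a m))\<^sup>2 = 2 * (norm (a n))\<^sup>2 + 2 * (norm (a m))\<^sup>2"
      by (simp add: power2_norm_eq_inner algebra_simps inner_commute)
    moreover have "1 / real (Suc m) \<le> 1 / real (Suc n)" using that by (simp add: frac_le)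
    ultimately show ?thesis using a(2)[of n] a(2)[of m] by simp
  qed
  have "Cauchy a"
  proof (rule metric_CauchyI)
    fix e :: real assume e: "0 < e"
    obtain N1 where N1: "\<And>m n. m \<ge> N1 \<Longrightarrow> n \<ge> N1 \<Longrightarrow> \<bar>d m - d n\<bar> < e\<^sup>2 / 8"
      using metric_CauchyD[OF Cauchy_d, of "e\<^sup>2 / 8"] e by (auto simp: dist_real_def)
    obtain N2 where N2: "1 / real (Suc N2) < e\<^sup>2 / 8"
      using nat_approx_posE[of "e\<^sup>2 / 8"] e by auto
    have main: "dist (a n) (a m) < e" if "n \<le> m" "max N1 N2 \<le> n" for m n
    proof -
      have "1 / real (Suc n) \<le> 1 / real (Suc N2)" using that by (simp add: frac_le)
      then have "4 / real (Suc n) < e\<^sup>2 / 2" using N2 by simp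
      moreover have "\<bar>d m - d n\<bar> < e\<^sup>2 / 8" using that by (intro N1) auto
      then have "d m - d n < e\<^sup>2 / 8" by (rule le_less_trans[OF abs_ge_self])
      moreover have "X < E" if "q < E / 2" "D < E / 8" "X \<le> 2 * D + q" "0 \<le> E" for X q D E :: real
        using that by linarith
      ultimately have "(norm (a n - a m))\<^sup>2 < e\<^sup>2" using near[OF that(1)] zero_le_power2[of e] by blast
      then show ?thesis using e by (simp add: dist_norm power_less_imp_less_base)
    qed
    show "\<exists>M. \<forall>m\<ge>M. \<forall>n\<ge>M. dist (a m) (a n) < e"
      using main by (metis dist_commute nat_le_linear)
  qed
  then obtain z where z: "a \<longlonglongrightarrow> z" using Cauchy_convergent convergent_def by blast
  have "z \<in> A n" for n
  proof (rule Lim_in_closed_set[OF closed])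
    show "\<forall>\<^sub>F m in sequentially. a m \<in> A n"
      using eventually_ge_at_top[of n] by eventually_elim (rule subsetD[OF dec a(1)])
  qed (use z in auto)
  then show ?thesis by blast
qed

text \<open>
  The projection onto \<open>C\<close>, with its variational inequality. Intersecting \<open>C\<close> with slightly too large balls
  around \<open>a\<close> produces a nearest point; moving from it towards \<open>y\<close> cannot decrease the distance.
\<close>

lemma nearest_point_obtuse_angle:
  fixes C :: "'a::{real_inner, complete_space} set"
  assumes "closed C" "convex C" "C \<noteq> {}"
  obtains z where "z \<in> C" "\<And>y. y \<in> C \<Longrightarrow> inner (z - a) (y - z) \<ge> 0"
proof -
  define r where "r n = infdist a C + 1 / real (Suc n)" for n
  have "\<exists>z. \<forall>n. z \<in> C \<inter> cball a (r n)"
  proof (rule decreasing_convex_sets_meet)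
    fix n :: nat
    have "infdist a C < r n" by (simp add: r_def)
    then obtain y where "y \<in> C" "dist a y < r n"
      using assms(3) by (auto simp: infdist_def cInf_less_iff)
    then show "C \<inter> cball a (r n) \<noteq> {}" by (auto intro: less_imp_le)
    fix m assume "m \<le> n"
    then have "1 / real (Suc n) \<le> 1 / real (Suc m)" by (simp add: frac_le)
    then have "r n \<le> r m" by (simp add: r_def)
    then show "C \<inter> cball a (r n) \<subseteq> C \<inter> cball a (r m)" by auto
  qed (use assms in \<open>auto intro: convex_Int\<close>)
  then obtain z where z: "z \<in> C" "\<And>n. dist a z \<le> r n" by auto
  have "dist a z \<le> infdist a C"
  proof (rule field_le_epsilon)
    fix e :: real assume "0 < e"
    then obtain n where "1 / real (Suc n) < e" by (rule nat_approx_posE)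
    then show "dist a z \<le> infdist a C + e" using z(2)[of n] by (simp add: r_def)
  qed
  then have least: "norm (z - a) \<le> norm (y - a)" if "y \<in> C" for y
    using infdist_le[OF that, of a] by (simp add: dist_norm norm_minus_commute)
  have "inner (z - a) (y - z) \<ge> 0" if y: "y \<in> C" for y
  proof (rule ccontr)
    assume "\<not> 0 \<le> inner (z - a) (y - z)"
    then have neg: "inner (z - a) (y - z) < 0" by simp
    then have "y \<noteq> z" by auto
    then have pos: "(norm (y - z))\<^sup>2 > 0" by simp
    \<comment> \<open>a step short enough that the quadratic term is dominated by half of the linear one\<close>
    define t where "t = min 1 (- inner (z - a) (y - z) / (norm (y - z))\<^sup>2)"
    have t: "0 < t" "t \<le> 1" using neg pos by (auto simp: t_def divide_neg_pos)
    have "t \<le> - inner (z - a) (y - z) / (norm (y - z))\<^sup>2" by (simp add: t_def)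
    then have t2: "t * (norm (y - z))\<^sup>2 \<le> - inner (z - a) (y - z)"
      using pos by (simp only: pos_le_divide_eq)
    have "(1 - t) *\<^sub>R z + t *\<^sub>R y \<in> C"
      using assms(2) z(1) y t by (simp add: convex_alt)
    then have "norm (z - a) \<le> norm ((1 - t) *\<^sub>R z + t *\<^sub>R y - a)" by (rule least)
    also have "(1 - t) *\<^sub>R z + t *\<^sub>R y - a = (z - a) + t *\<^sub>R (y - z)" by (simp add: algebra_simps)
    finally have "(norm (z - a))\<^sup>2 \<le> (norm ((z - a) + t *\<^sub>R (y - z)))\<^sup>2" by (simp add: power_mono)
    also have "\<dots> = (norm (z - a))\<^sup>2 + t * (2 * inner (z - a) (y - z) + t * (norm (y - z))\<^sup>2)"
      by (simp only: power2_norm_eq_inner inner_add_left inner_add_right inner_scaleR_left inner_scaleR_right)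
         (simp add: algebra_simps inner_commute)
    finally have "0 \<le> t * (2 * inner (z - a) (y - z) + t * (norm (y - z))\<^sup>2)" by simp
    then have "0 \<le> 2 * inner (z - a) (y - z) + t * (norm (y - z))\<^sup>2"
      using t(1) by (simp add: zero_le_mult_iff)
    then show False using t2 neg by linarith
  qed
  with z(1) show ?thesis using that by blast
qed

text \<open>
  The pairs in \<open>A \<times> B\<close> whose difference is nearly \<open>l\<close> form nested sets in the product Hilbert space;
  a common point is a pair with difference exactly \<open>l\<close>.
\<close>

lemma closed_difference_of_bounded_convex_sets:
  fixes A B :: "'a::{real_inner, complete_space} set"
  assumes A: "closed A" "convex A" "bounded A" and B: "closed B" "convex B" "bounded B"
  shows "closed {a - b | a b. a \<in> A \<and> b \<in> B}"
  unfolding closed_sequential_limits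
proof (intro allI impI)
  fix w l assume *: "(\<forall>n. w n \<in> {a - b |a b. a \<in> A \<and> b \<in> B}) \<and> w \<longlonglongrightarrow> l"
  define D where "D n = (A \<times> B) \<inter> (\<lambda>z. fst z - snd z) -` cball l (1 / real (Suc n))" for n
  have "\<exists>z. \<forall>n. z \<in> D n"
  proof (rule decreasing_convex_sets_meet)
    fix n :: nat
    show "closed (D n)"
      unfolding D_def using A B
      by (intro closed_Int closed_Times continuous_closed_vimage) (auto intro!: continuous_intros)
    have "linear (\<lambda>z :: 'a \<times> 'a. fst z - snd z)"
      by (intro linearI) (auto simp: algebra_simps)
    then show "convex (D n)"
      unfolding D_def using A B by (intro convex_Int convex_Times convex_linear_vimage) auto
    have "\<forall>\<^sub>F k in sequentially. dist (w k) l < 1 / real (Suc n)"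
      using * by (intro tendstoD) auto
    then obtain k where k: "dist (w k) l < 1 / real (Suc n)" using eventually_happens by force
    obtain a b where "a \<in> A" "b \<in> B" "w k = a - b" using * by blast
    then have "(a, b) \<in> D n" using k by (simp add: D_def dist_commute)
    then show "D n \<noteq> {}" by blast
    fix m assume "m \<le> n"
    then have "1 / real (Suc n) \<le> 1 / real (Suc m)" by (simp add: frac_le)
    then have "cball l (1 / real (Suc n)) \<subseteq> cball l (1 / real (Suc m))" by (rule subset_cball)
    then show "D n \<subseteq> D m" unfolding D_def by blast
  next
    have "D 0 \<subseteq> A \<times> B" by (simp add: D_def)
    then show "bounded (D 0)" by (rule bounded_subset[OF bounded_Times[OF A(3) B(3)]])
  qed
  then obtain a b where ab: "\<And>n. (a, b) \<in> D n" by auto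
  then have "a \<in> A" "b \<in> B" and d: "\<And>n. dist l (a - b) \<le> 1 / real (Suc n)"
    by (auto simp: D_def)
  have "dist l (a - b) \<le> 0"
  proof (rule field_le_epsilon)
    fix e :: real assume "0 < e"
    then obtain n where "1 / real (Suc n) < e" by (rule nat_approx_posE)
    then show "dist l (a - b) \<le> 0 + e" using d[of n] by simp
  qed
  then have "l = a - b" by simp
  with \<open>a \<in> A\<close> \<open>b \<in> B\<close> show "l \<in> {a - b |a b. a \<in> A \<and> b \<in> B}" by blast
qed

lemma closed_sublevel:
  fixes h :: "'a::metric_space \<Rightarrow> real"
  assumes "closed K" "lower_semicontinuous_on K h"
  shows "closed {k \<in> K. h k \<le> c}"
  unfolding closed_sequential_limits
proof (intro allI impI)
  fix y l assume *: "(\<forall>n. y n \<in> {k \<in> K. h k \<le> c}) \<and> y \<longlonglongrightarrow> l"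
  then have l: "l \<in> K" using assms(1) unfolding closed_sequential_limits by blast
  have "h l \<le> c"
  proof (rule ccontr)
    assume "\<not> h l \<le> c"
    then have "\<forall>\<^sub>F y in at l within K. c < h y"
      using assms(2) l by (auto simp: lower_semicontinuous_on_def)
    then have ev: "\<forall>\<^sub>F y in nhds l. y \<noteq> l \<longrightarrow> y \<in> K \<longrightarrow> c < h y"
      unfolding eventually_at_filter .
    have "\<forall>\<^sub>F n in sequentially. y n \<noteq> l \<longrightarrow> y n \<in> K \<longrightarrow> c < h (y n)"
      using * ev by (auto simp: filterlim_iff)
    then obtain n where "y n \<noteq> l \<longrightarrow> y n \<in> K \<longrightarrow> c < h (y n)" using eventually_happens by force
    then show False using * \<open>\<not> h l \<le> c\<close> by (metis (mono_tags, lifting) mem_Collect_eq not_le)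
  qed
  with l show "l \<in> {k \<in> K. h k \<le> c}" by simp
qed

lemma convex_sublevel:
  fixes h :: "'a::real_vector \<Rightarrow> real"
  assumes "convex_on K h"
  shows "convex {k \<in> K. h k \<le> c}"
proof (rule convexI)
  fix x y :: 'a and u v :: real
  assume *: "x \<in> {k \<in> K. h k \<le> c}" "y \<in> {k \<in> K. h k \<le> c}" "0 \<le> u" "0 \<le> v" "u + v = 1"
  have "h (u *\<^sub>R x + v *\<^sub>R y) \<le> u * h x + v * h y" using assms * by (auto simp: convex_on_def)
  also have "\<dots> \<le> u * c + v * c" using * by (intro add_mono mult_left_mono) auto
  also have "\<dots> = c" using * by (simp add: distrib_right[symmetric])
  finally show "u *\<^sub>R x + v *\<^sub>R y \<in> {k \<in> K. h k \<le> c}"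
    using assms * by (auto simp: convex_on_def convex_def)
qed

section \<open>Multipliers under a closed subspace qualification\<close>

lemma convex_two_point_average:
  assumes "convex A" "x \<in> A" "y \<in> A" "0 < a" "0 < b"
  shows "(1 / (a + b)) *\<^sub>R (a *\<^sub>R x + b *\<^sub>R y) \<in> A"
proof -
  have "(a / (a + b)) *\<^sub>R x + (b / (a + b)) *\<^sub>R y \<in> A"
    using assms by (intro convexD) (auto simp: add_divide_distrib[symmetric])
  then show ?thesis by (simp add: scaleR_right_distrib)
qed

lemma convex_on_two_point_average:
  fixes h :: "'a::real_vector \<Rightarrow> real"
  assumes "convex_on A h" "x \<in> A" "y \<in> A" "0 < a" "0 < b"
  shows "(a + b) * h ((1 / (a + b)) *\<^sub>R (a *\<^sub>R x + b *\<^sub>R y)) \<le> a * h x + b * h y"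
proof -
  have *: "a / (a + b) + b / (a + b) = 1" using assms(4,5) by (simp add: add_divide_distrib[symmetric])
  have "h ((a / (a + b)) *\<^sub>R x + (b / (a + b)) *\<^sub>R y) \<le> a / (a + b) * h x + b / (a + b) * h y"
    using assms * by (auto simp: convex_on_def simp del: times_divide_eq_left)
  then have "(a + b) * h ((1 / (a + b)) *\<^sub>R (a *\<^sub>R x + b *\<^sub>R y)) \<le> (a + b) * (a / (a + b) * h x + b / (a + b) * h y)"
    using assms by (intro mult_left_mono) (auto simp: scaleR_right_distrib)
  also have "\<dots> = a * h x + b * h y" using assms(4,5) by (simp add: distrib_left)
  finally show ?thesis .
qed

text \<open>
  A convex function \<open>h\<close> on \<open>K\<close> whose minimum over \<open>K \<inter> C\<close> is attained at \<open>u\<close> with value \<open>0\<close>, where the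
  cone generated by \<open>K - C\<close> is a closed subspace.
\<close>

locale convex_constraint_pair =
  fixes K C :: "'a::{real_inner, complete_space} set" and h :: "'a \<Rightarrow> real" and u :: 'a
    and V :: "'a set"
  assumes K: "closed K" "convex K" and C: "closed C" "convex C"
    and h: "convex_on K h" "lower_semicontinuous_on K h"
    and u: "u \<in> K" "u \<in> C" "h u = 0" and h_nonneg: "\<And>k. k \<in> K \<Longrightarrow> k \<in> C \<Longrightarrow> 0 \<le> h k"
    and V_def: "V = {t *\<^sub>R (k - s) | t k s. 0 \<le> t \<and> k \<in> K \<and> s \<in> C}"
    and V: "subspace V" "closed V"
begin

text \<open>
  The bounds on \<open>k\<close>, \<open>s\<close> and \<open>h k\<close> make each cell closed; the scaling lets countably many cells exhaust \<open>V\<close>.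
\<close>

definition cell :: "nat \<Rightarrow> 'a set" where
  "cell n = (\<lambda>z. real (Suc n) *\<^sub>R z) `
    {k - s | k s. k \<in> {k \<in> K. h k \<le> real n} \<inter> cball u (real n) \<and> s \<in> C \<inter> cball u (real n)}"

lemma closed_cell: "closed (cell n)"
  unfolding cell_def using K C h
  by (intro closed_scaling closed_difference_of_bounded_convex_sets closed_Int convex_Int
      closed_sublevel convex_sublevel bounded_Int) auto

text \<open>
  Shrinking a pair \<open>(k, s)\<close> towards \<open>(u, u)\<close> keeps it in \<open>K \<times> C\<close>, does not increase the distances to \<open>u\<close>,
  keeps \<open>h\<close> bounded by convexity, and only scales the difference \<open>k - s\<close>; a large scaling factor compensates.
\<close>

lemma cells_cover: "V = (\<Union>n. cell n)"
proof
  show "(\<Union>n. cell n) \<subseteq> V"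
  proof
    fix v assume "v \<in> (\<Union>n. cell n)"
    then obtain n k s where "v = real (Suc n) *\<^sub>R (k - s)" "k \<in> K" "s \<in> C"
      by (auto simp: cell_def)
    then show "v \<in> V" unfolding V_def by (intro CollectI exI[of _ "real (Suc n)"]) auto
  qed
next
  show "V \<subseteq> (\<Union>n. cell n)"
  proof
    fix v assume "v \<in> V"
    then obtain t k s where v: "v = t *\<^sub>R (k - s)" "0 \<le> t" "k \<in> K" "s \<in> C"
      unfolding V_def by blast
    obtain n where n: "max (max t \<bar>h k\<bar>) (max (dist u k) (dist u s)) < real n"
      using reals_Archimedean2 by blast
    define \<theta> where "\<theta> = t / real (Suc n)"
    have \<theta>: "0 \<le> \<theta>" "\<theta> \<le> 1" using v n by (auto simp: \<theta>_def)
    define k' s' where "k' = (1 - \<theta>) *\<^sub>R u + \<theta> *\<^sub>R k" and "s' = (1 - \<theta>) *\<^sub>R u + \<theta> *\<^sub>R s"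
    have k': "k' \<in> K" using K u v \<theta> by (simp add: k'_def convex_alt)
    have s': "s' \<in> C" using C u v \<theta> by (simp add: s'_def convex_alt)
    have "h k' \<le> (1 - \<theta>) * h u + \<theta> * h k"
      unfolding k'_def using h u v \<theta> by (intro convex_onD) auto
    also have "\<dots> \<le> 1 * \<bar>h k\<bar>" using u \<theta> mult_right_mono[of \<theta> 1 "\<bar>h k\<bar>"] mult_left_mono[OF abs_ge_self[of "h k"], of \<theta>] by simp
    finally have hk': "h k' \<le> real n" using n by simp
    have contract: "dist u ((1 - \<theta>) *\<^sub>R u + \<theta> *\<^sub>R w) \<le> dist u w" for w
    proof -
      have "u - ((1 - \<theta>) *\<^sub>R u + \<theta> *\<^sub>R w) = \<theta> *\<^sub>R (u - w)" by (simp add: algebra_simps)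
      then show ?thesis using \<theta> by (simp add: dist_norm mult_left_le_one_le)
    qed
    have "k' \<in> cball u (real n)" "s' \<in> cball u (real n)"
      using contract[of k] contract[of s] n by (auto simp: k'_def s'_def)
    moreover have "v = real (Suc n) *\<^sub>R (k' - s')"
      unfolding v(1) k'_def s'_def by (simp add: \<theta>_def scaleR_right_diff_distrib[symmetric])
    ultimately have "v \<in> cell n" unfolding cell_def using k' s' hk' by blast
    then show "v \<in> (\<Union>n. cell n)" by blast
  qed
qed

text \<open>
  The value function \<open>w \<mapsto> inf {h k | k - s = w}\<close> is bounded above near the origin of \<open>V\<close>, up to a
  scaling of \<open>w\<close>. By Baire some cell contains a relative ball around some \<open>v\<close>. Since \<open>- v\<close> also is a multiple of
  a difference, averaging with the corresponding pair moves the centre of the ball to \<open>0\<close>.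
\<close>

lemma differences_fill_a_ball:
  obtains r N M where "r > 0" "N > 0" "M \<ge> 0"
    "\<And>w. w \<in> V \<Longrightarrow> norm w < r \<Longrightarrow> \<exists>k\<in>K. \<exists>s\<in>C. w = N *\<^sub>R (k - s) \<and> h k \<le> M"
proof -
  have "\<exists>n. top_of_set V interior_of cell n \<noteq> {}"
  proof (rule ccontr)
    assume contra: "\<nexists>n. top_of_set V interior_of cell n \<noteq> {}"
    have "top_of_set V interior_of \<Union>(range cell) = {}"
    proof (rule Baire_category_alt)
      show "completely_metrizable_space (top_of_set V) \<or>
          locally_compact_space (top_of_set V) \<and> regular_space (top_of_set V)"
        using V(2) completely_metrizable_space_closedin[OF completely_metrizable_space_euclidean]
        by auto
    next
      fix T assume "T \<in> range cell"
      then obtain n where T: "T = cell n" by auto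
      have "cell n \<subseteq> V" using cells_cover by blast
      then show "closedin (top_of_set V) T \<and> top_of_set V interior_of T = {}"
        using contra closed_cell[of n] by (auto simp: T closed_subset)
    qed auto
    moreover have "top_of_set V interior_of V = V"
      by (metis interior_of_topspace topspace_euclidean_subtopology)
    ultimately show False using cells_cover subspace_0[OF V(1)] by auto
  qed
  then obtain n v where "v \<in> top_of_set V interior_of cell n" by blast
  then obtain T where T: "openin (top_of_set V) T" "v \<in> T" "T \<subseteq> cell n"
    by (auto simp: interior_of_def)
  then have vV: "v \<in> V" using openin_imp_subset by blast
  obtain r where r: "r > 0" "ball v r \<inter> V \<subseteq> T"
    using T by (auto simp: openin_contains_ball)
  have "- v \<in> V" using V(1) vV by (rule subspace_neg)
  \<comment> \<open>a positive scaling factor is wanted; if \<open>v = 0\<close> the pair \<open>(u, u)\<close> will do\<close>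
  then obtain t k1 s1 where v: "- v = t *\<^sub>R (k1 - s1)" "0 < t" "k1 \<in> K" "s1 \<in> C"
  proof -
    from \<open>- v \<in> V\<close> obtain t k1 s1 where t: "- v = t *\<^sub>R (k1 - s1)" "0 \<le> t" "k1 \<in> K" "s1 \<in> C"
      unfolding V_def by blast
    show ?thesis
    proof (cases "t = 0")
      case True
      then show ?thesis using that[of 1 u u] t u by simp
    qed (use that t in auto)
  qed
  define m where "m = real (Suc n)"
  have m: "m > 0" by (simp add: m_def)
  define M where "M = (m * real n + t * \<bar>h k1\<bar>) / (m + t)"
  have "\<exists>k\<in>K. \<exists>s\<in>C. w = (m + t) *\<^sub>R (k - s) \<and> h k \<le> M" if w: "w \<in> V" "norm w < r" for w
  proof -
    have "v + w \<in> ball v r \<inter> V" using w vV V(1) by (simp add: dist_norm subspace_add)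
    then have "v + w \<in> cell n" using r T by blast
    then obtain k s where ks: "v + w = m *\<^sub>R (k - s)" "k \<in> K" "h k \<le> real n" "s \<in> C"
      unfolding cell_def m_def by blast
    define k' s' where "k' = (1 / (m + t)) *\<^sub>R (m *\<^sub>R k + t *\<^sub>R k1)"
      and "s' = (1 / (m + t)) *\<^sub>R (m *\<^sub>R s + t *\<^sub>R s1)"
    have "k' \<in> K" "s' \<in> C"
      unfolding k'_def s'_def using K C ks v m by (auto intro: convex_two_point_average)
    moreover have "w = (m + t) *\<^sub>R (k' - s')"
    proof -
      have "w = m *\<^sub>R (k - s) + t *\<^sub>R (k1 - s1)" using ks(1) v(1) by (simp add: algebra_simps)
      also have "\<dots> = (m *\<^sub>R k + t *\<^sub>R k1) - (m *\<^sub>R s + t *\<^sub>R s1)" by (simp add: algebra_simps)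
      also have "\<dots> = (m + t) *\<^sub>R (k' - s')"
        using m v(2) by (simp add: k'_def s'_def scaleR_right_diff_distrib)
      finally show ?thesis .
    qed
    moreover have "h k' \<le> M"
    proof -
      have "(m + t) * h k' \<le> m * h k + t * h k1"
        unfolding k'_def using h ks v m by (intro convex_on_two_point_average)
      also have "\<dots> \<le> m * real n + t * \<bar>h k1\<bar>" using ks v m by (intro add_mono mult_left_mono) auto
      finally show ?thesis using m v(2) by (simp add: M_def pos_le_divide_eq mult.commute)
    qed
    ultimately show ?thesis by blast
  qed
  moreover have "M \<ge> 0" unfolding M_def using m v(2) by simp
  ultimately show ?thesis using that[of r "m + t" M] r(1) v(2) m by simp
qed

text \<open>
  A convex function that is bounded above near a point where it vanishes cannot decrease faster than linearly.
  Concretely, a pair \<open>(k, s)\<close> is averaged with a pair whose difference points in the opposite direction, so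
  that both averages coincide in a point of \<open>K \<inter> C\<close>, where \<open>h\<close> is nonnegative.
\<close>

lemma exact_penalty:
  obtains L where "L > 0" "\<And>k s. k \<in> K \<Longrightarrow> s \<in> C \<Longrightarrow> h k \<ge> - L * norm (k - s)"
proof -
  obtain r N M where rNM: "r > 0" "N > 0" "M \<ge> 0"
    and fill: "\<And>w. w \<in> V \<Longrightarrow> norm w < r \<Longrightarrow> \<exists>k\<in>K. \<exists>s\<in>C. w = N *\<^sub>R (k - s) \<and> h k \<le> M"
    using differences_fill_a_ball by metis
  define L where "L = 2 * N * M / r"
  have main: "h k \<ge> - L * norm (k - s)" if ks: "k \<in> K" "s \<in> C" for k s
  proof (cases "k = s")
    case True
    then show ?thesis using h_nonneg ks by auto
  next
    case False
    \<comment> \<open>scales \<open>k - s\<close> into the ball of radius \<open>r\<close>, where its negative is a known multiple of a difference\<close>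
    define c where "c = r / (2 * norm (k - s))"
    have c: "c > 0" using False rNM by (simp add: c_def)
    have "k - s = 1 *\<^sub>R (k - s)" by simp
    then have "k - s \<in> V" unfolding V_def using ks zero_le_one by blast
    then have "(- c) *\<^sub>R (k - s) \<in> V" using V(1) subspace_scale by blast
    moreover have "norm ((- c) *\<^sub>R (k - s)) < r" using False rNM by (simp add: c_def)
    ultimately obtain k' s' where ks': "k' \<in> K" "s' \<in> C" "(- c) *\<^sub>R (k - s) = N *\<^sub>R (k' - s')" "h k' \<le> M"
      using fill by blast
    define z where "z = (1 / (c + N)) *\<^sub>R (c *\<^sub>R k + N *\<^sub>R k')"
    have "c *\<^sub>R k + N *\<^sub>R k' = c *\<^sub>R s + N *\<^sub>R s'"
      using ks'(3) by (simp add: algebra_simps)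
    then have "z \<in> C" unfolding z_def using C ks ks' c rNM by (simp add: convex_two_point_average)
    moreover have "z \<in> K" unfolding z_def using K ks ks' c rNM by (intro convex_two_point_average)
    ultimately have "0 \<le> (c + N) * h z" using h_nonneg c rNM by simp
    also have "\<dots> \<le> c * h k + N * h k'"
      unfolding z_def using h ks ks' c rNM by (intro convex_on_two_point_average)
    also have "\<dots> \<le> c * h k + N * M" using ks' rNM by simp
    finally have "- (N * M) \<le> h k * c" by (simp add: mult.commute)
    then have "- (N * M) / c \<le> h k" using c by (simp only: pos_divide_le_eq)
    moreover have "- (N * M) / c = - L * norm (k - s)"
      using False rNM by (simp add: c_def L_def field_simps)
    ultimately show ?thesis by simp
  qed
  have "h k \<ge> - (L + 1) * norm (k - s)" if "k \<in> K" "s \<in> C" for k s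
  proof -
    have "- (L + 1) * norm (k - s) = - L * norm (k - s) - norm (k - s)" by (simp add: algebra_simps)
    then show ?thesis using main[OF that] norm_ge_zero[of "k - s"] by linarith
  qed
  moreover have "0 \<le> L" using rNM by (simp add: L_def)
  ultimately show ?thesis using that[of "L + 1"] by simp
qed

text \<open>
  Let \<open>E\<close> be the epigraph of the value function and \<open>(w, t)\<close> the point of its closure nearest to \<open>(0, - \<epsilon>)\<close>.
  The normal direction there is \<open>(w, \<tau>)\<close> with \<open>\<tau> = t + \<epsilon>\<close>, and \<open>p = w/\<tau>\<close> is the slope of a supporting
  affine function. The penalty bound, which says that \<open>E\<close> lies above a cone of slope \<open>L\<close>, forbids a vertical
  supporting hyperplane (\<open>\<tau> = 0\<close>) and limits the slope by \<open>L\<close>.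
\<close>

lemma approximate_multiplier:
  assumes L: "L > 0" "\<And>k s. k \<in> K \<Longrightarrow> s \<in> C \<Longrightarrow> h k \<ge> - L * norm (k - s)" and "\<epsilon> > 0"
  shows "\<exists>p. norm p \<le> L \<and> (\<forall>k\<in>K. \<forall>s\<in>C. h k + inner p (k - s) \<ge> - \<epsilon>)"
proof -
  define E where "E = {(k - s, t) | k s t. k \<in> K \<and> s \<in> C \<and> h k \<le> t}"
  have "convex E"
  proof (rule convexI)
    fix x y and a b :: real
    assume "x \<in> E" "y \<in> E" and ab: "0 \<le> a" "0 \<le> b" "a + b = 1"
    then obtain k s t k' s' t' where x: "x = (k - s, t)" "k \<in> K" "s \<in> C" "h k \<le> t"
      and y: "y = (k' - s', t')" "k' \<in> K" "s' \<in> C" "h k' \<le> t'" by (auto simp: E_def)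
    have "h (a *\<^sub>R k + b *\<^sub>R k') \<le> a * h k + b * h k'"
      using h(1) x y ab by (auto simp: convex_on_def)
    also have "\<dots> \<le> a * t + b * t'" using x y ab by (intro add_mono mult_left_mono)
    finally have "h (a *\<^sub>R k + b *\<^sub>R k') \<le> a * t + b * t'" .
    moreover have "a *\<^sub>R x + b *\<^sub>R y = ((a *\<^sub>R k + b *\<^sub>R k') - (a *\<^sub>R s + b *\<^sub>R s'), a * t + b * t')"
      using x y by (simp add: algebra_simps)
    moreover have "a *\<^sub>R k + b *\<^sub>R k' \<in> K" "a *\<^sub>R s + b *\<^sub>R s' \<in> C"
      using K C x y ab by (auto intro: convexD)
    ultimately show "a *\<^sub>R x + b *\<^sub>R y \<in> E" unfolding E_def by blast
  qed
  have E0: "(0, 0) \<in> E" using u unfolding E_def by force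
  have cone: "t \<ge> - L * norm w" if "(w, t) \<in> closure E" for w t
  proof -
    have "E \<subseteq> {z. - L * norm (fst z) \<le> snd z}" using L(2) by (force simp: E_def)
    moreover have "closed {z :: 'a \<times> real. - L * norm (fst z) \<le> snd z}"
      by (intro closed_Collect_le continuous_intros)
    ultimately have "closure E \<subseteq> {z. - L * norm (fst z) \<le> snd z}" by (rule closure_minimal)
    with that show ?thesis by auto
  qed
  obtain z where "z \<in> closure E"
    and zang: "\<And>y. y \<in> closure E \<Longrightarrow> inner (z - (0, - \<epsilon>)) (y - z) \<ge> 0"
    using nearest_point_obtuse_angle[of "closure E" "(0, - \<epsilon>)"] \<open>convex E\<close> E0 by auto
  obtain w t where z: "z = (w, t)" by (cases z)
  define \<tau> where "\<tau> = t + \<epsilon>"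
  have ang: "inner w w + \<tau> * t \<le> inner w w' + \<tau> * t'" if "(w', t') \<in> E" for w' t'
    using zang[of "(w', t')"] that closure_subset[of E]
    by (auto simp: z \<tau>_def inner_diff_right algebra_simps)
  have tw: "t \<ge> - L * norm w" using cone \<open>z \<in> closure E\<close> z by blast
  have "inner w w + \<tau> * t \<le> \<tau> * t'" if "t' \<ge> 0" for t'
  proof -
    have "(0, t') \<in> E" using u that unfolding E_def by force
    from ang[OF this] show ?thesis by simp
  qed
  from this[of "\<bar>t\<bar> + 1"] this[of 0]
  have up: "inner w w + \<tau> * t \<le> \<tau> * (\<bar>t\<bar> + 1)" and zero: "inner w w + \<tau> * t \<le> 0" by auto
  \<comment> \<open>\<open>E\<close> is unbounded upwards, so its normal direction points upwards\<close>
  have "0 \<le> \<tau>"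
  proof (rule ccontr)
    assume "\<not> 0 \<le> \<tau>"
    then have "\<tau> * (\<bar>t\<bar> + 1) < \<tau> * t" by (intro mult_strict_left_mono_neg) auto
    then show False using up inner_ge_zero[of w] by linarith
  qed
  moreover have "\<tau> \<noteq> 0"
  proof
    assume \<tau>0: "\<tau> = 0"
    then have "w = 0" using zero inner_ge_zero[of w] by simp
    then show False using tw \<tau>0 \<open>\<epsilon> > 0\<close> by (simp add: \<tau>_def)
  qed
  ultimately have \<tau>: "\<tau> > 0" by simp
  define p where "p = (1 / \<tau>) *\<^sub>R w"
  have "norm w * norm w \<le> \<tau> * (L * norm w)"
  proof -
    have "\<tau> * (- t) \<le> \<tau> * (L * norm w)" using tw \<tau> by (intro mult_left_mono) auto
    then show ?thesis using zero by (simp add: power2_norm_eq_inner[symmetric] power2_eq_square)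
  qed
  then have "norm w \<le> \<tau> * L"
    using \<tau> L(1) by (cases "norm w = 0") (auto simp: mult.assoc[symmetric])
  then have "norm p \<le> L" using \<tau> by (simp add: p_def field_simps)
  moreover have "h k + inner p (k - s) \<ge> - \<epsilon>" if "k \<in> K" "s \<in> C" for k s
  proof -
    have "(k - s, h k) \<in> E" using that unfolding E_def by blast
    from ang[OF this] have "\<tau> * t \<le> inner w (k - s) + \<tau> * h k" using inner_ge_zero[of w] by linarith
    also have "inner w (k - s) = \<tau> * inner p (k - s)" using \<tau> by (simp add: p_def)
    finally have "\<tau> * t \<le> \<tau> * (h k + inner p (k - s))" by (simp add: algebra_simps)
    then have "t \<le> h k + inner p (k - s)" using \<tau> by simp
    then show ?thesis using \<tau> by (simp add: \<tau>_def)
  qed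
  ultimately show ?thesis by blast
qed

text \<open>
  The bound \<open>L\<close> on the approximate multipliers does not depend on \<open>\<epsilon>\<close>, so the sets of \<open>\<epsilon>\<close>-multipliers in the
  ball of radius \<open>L\<close> have a common point as \<open>\<epsilon>\<close> decreases to \<open>0\<close>.
\<close>

lemma multiplier_exists:
  "\<exists>p. \<forall>k\<in>K. \<forall>s\<in>C. h k + inner p (k - s) \<ge> 0"
proof -
  obtain L where L: "L > 0" "\<And>k s. k \<in> K \<Longrightarrow> s \<in> C \<Longrightarrow> h k \<ge> - L * norm (k - s)"
    using exact_penalty by blast
  define P where "P n = cball 0 L \<inter> (\<Inter>k\<in>K. \<Inter>s\<in>C. {p. inner (k - s) p \<ge> - h k - 1 / real (Suc n)})" for n
  have "\<exists>p. \<forall>n. p \<in> P n"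
  proof (rule decreasing_convex_sets_meet)
    fix n :: nat
    show "closed (P n)" unfolding P_def
      by (intro closed_Int closed_INT ballI closed_halfspace_ge) auto
    show "convex (P n)" unfolding P_def
      by (intro convex_Int convex_INT convex_halfspace_ge) auto
    obtain p where "norm p \<le> L" "\<forall>k\<in>K. \<forall>s\<in>C. h k + inner p (k - s) \<ge> - (1 / real (Suc n))"
      using approximate_multiplier[OF L, of "1 / real (Suc n)"] by auto
    then have "p \<in> P n" unfolding P_def by (force simp: inner_commute)
    then show "P n \<noteq> {}" by blast
    fix m assume "m \<le> n"
    then have "1 / real (Suc n) \<le> 1 / real (Suc m)" by (simp add: frac_le)
    then show "P n \<subseteq> P m" unfolding P_def by force
  next
    show "bounded (P 0)" unfolding P_def by (intro bounded_Int) auto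
  qed
  then obtain p where p: "\<And>n. p \<in> P n" by blast
  have "h k + inner p (k - s) \<ge> 0" if ks: "k \<in> K" "s \<in> C" for k s
  proof (rule field_le_epsilon)
    fix e :: real assume "0 < e"
    then obtain n where n: "1 / real (Suc n) < e" by (rule nat_approx_posE)
    have "inner (k - s) p \<ge> - h k - 1 / real (Suc n)" using p[of n] ks unfolding P_def by blast
    then show "0 \<le> h k + inner p (k - s) + e" using n by (simp add: inner_commute)
  qed
  then show ?thesis by blast
qed

end

section \<open>Equilibrium problems\<close>

text \<open>
  Minty's lemma. On the segment from \<open>z\<close> to \<open>y\<close> convexity gives \<open>0 = f w w \<le> t f w y + (1 - t) f w z\<close>, hence
  \<open>f w y \<ge> 0\<close>, and upper hemicontinuity transports this to the endpoint \<open>z\<close>. The set \<open>C\<close> may be smaller than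
  \<open>K\<close> because the upper-level problem is posed on the solution set of the lower-level one.
\<close>

lemma minty:
  assumes f: "upper_hemicontinuous K f" "equilibrium_bifunction K f"
    and C: "convex C" "C \<subseteq> K" and z: "z \<in> C" and dual: "\<And>y. y \<in> C \<Longrightarrow> f y z \<le> 0" and y: "y \<in> C"
  shows "0 \<le> f z y"
proof -
  have seg: "0 \<le> f (t *\<^sub>R y + (1 - t) *\<^sub>R z) y" if t: "0 < t" "t < 1" for t
  proof -
    define w where "w = t *\<^sub>R y + (1 - t) *\<^sub>R z"
    have w: "w \<in> C" unfolding w_def using C(1) y z t by (intro convexD) auto
    then have "convex_on K (f w)" "f w w = 0" using f(2) C(2) by (auto simp: equilibrium_bifunction_def)
    then have "f w (t *\<^sub>R y + (1 - t) *\<^sub>R z) \<le> t * f w y + (1 - t) * f w z"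
      using subsetD[OF C(2) y] subsetD[OF C(2) z] t by (simp add: convex_on_def)
    then have "f w w \<le> t * f w y + (1 - t) * f w z" by (simp add: w_def[symmetric])
    moreover have "(1 - t) * f w z \<le> 0" using dual[OF w] t by (simp add: mult_nonneg_nonpos)
    ultimately have "0 \<le> t * f w y" using \<open>f w w = 0\<close> by linarith
    then show ?thesis using t by (simp add: zero_le_mult_iff w_def)
  qed
  have "0 \<le> Limsup (at_right (0::real)) (\<lambda>t. ereal (f (t *\<^sub>R y + (1 - t) *\<^sub>R z) y))"
  proof (rule le_Limsup)
    have "\<forall>\<^sub>F t in at_right (0::real). t < 1" by (auto simp: eventually_at_right_field intro: exI[of _ 1])
    moreover have "\<forall>\<^sub>F t in at_right (0::real). 0 < t" by (rule eventually_at_right_less)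
    ultimately show "\<forall>\<^sub>F t in at_right 0. 0 \<le> ereal (f (t *\<^sub>R y + (1 - t) *\<^sub>R z) y)"
      by eventually_elim (use seg in simp)
  qed simp
  also have "\<dots> \<le> ereal (f z y)"
    using f(1) y z C(2) unfolding upper_hemicontinuous_def by blast
  finally show ?thesis by simp
qed

text \<open>
  The right-hand side is an intersection of sublevel sets of convex lower semicontinuous functions. It is also
  intersected with \<open>K\<close> so that the equation does not depend on \<open>K\<close> being nonempty.
\<close>

lemma equilibrium_solutions_dual:
  assumes "convex K" and f: "monotone_bifunction K f" "upper_hemicontinuous K f" "equilibrium_bifunction K f"
  shows "equilibrium_solutions K f = (\<Inter>y\<in>K. {z \<in> K. f y z \<le> 0}) \<inter> K"
proof
  show "equilibrium_solutions K f \<subseteq> (\<Inter>y\<in>K. {z \<in> K. f y z \<le> 0}) \<inter> K"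
  proof
    fix z assume z: "z \<in> equilibrium_solutions K f"
    have "f y z \<le> 0" if y: "y \<in> K" for y
    proof -
      have "0 \<le> f z y" "f z y + f y z \<le> 0"
        using z y f(1) by (auto simp: equilibrium_solutions_def monotone_bifunction_def)
      then show ?thesis by linarith
    qed
    then show "z \<in> (\<Inter>y\<in>K. {z \<in> K. f y z \<le> 0}) \<inter> K"
      using z by (auto simp: equilibrium_solutions_def)
  qed
  show "(\<Inter>y\<in>K. {z \<in> K. f y z \<le> 0}) \<inter> K \<subseteq> equilibrium_solutions K f"
    using minty[OF f(2,3) assms(1) subset_refl] by (auto simp: equilibrium_solutions_def)
qed

lemma equilibrium_solutions_closed_convex:
  assumes "closed K" "convex K"
    and f: "monotone_bifunction K f" "upper_hemicontinuous K f" "equilibrium_bifunction K f"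
  shows "closed (equilibrium_solutions K f)" "convex (equilibrium_solutions K f)"
  unfolding equilibrium_solutions_dual[OF assms(2-5)] using assms
  by (auto simp: equilibrium_bifunction_def intro!: closed_Int closed_INT convex_Int convex_INT
      closed_sublevel convex_sublevel)

section \<open>Weak convergence without weak compactness\<close>

lemma in_closed_convex_of_hull:
  assumes "z \<in> closure (convex hull Y)" "Y \<subseteq> D" "closed D" "convex D"
  shows "z \<in> D"
  using assms closure_minimal hull_minimal by (metis subsetD)

lemma bounded_of_convergent_distance:
  fixes x :: "nat \<Rightarrow> 'a::real_normed_vector"
  assumes "convergent (\<lambda>n. (norm (x n - s))\<^sup>2)"
  shows "bounded (range x)"
proof -
  obtain B where B: "\<And>n. norm ((norm (x n - s))\<^sup>2) \<le> B"
    using convergent_imp_Bseq[OF assms] unfolding Bseq_def by blast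
  have "norm (x n - s) \<le> sqrt B" for n
    using B[of n] by (intro real_le_rsqrt) simp
  then show ?thesis by (auto simp: bounded_any_center[of _ s] dist_norm norm_minus_commute)
qed

text \<open>
  A variant of Opial's lemma in which the points common to the closed convex hulls of all tails take the role of
  the weak cluster points. If \<open>z\<close> and \<open>z'\<close> are two such points, then \<open>\<langle>x\<^sub>n, z - z'\<rangle>\<close> converges, since it is a
  combination of squared distances, and both \<open>\<langle>z, z - z'\<rangle>\<close> and \<open>\<langle>z', z - z'\<rangle>\<close> equal its limit; so
  \<open>z = z'\<close>. If a functional failed to converge to its value at \<open>z\<close>, then the hulls over the bad indices
  would have a common point too, different from \<open>z\<close>.
\<close>

lemma weak_convergence_from_tail_hulls:
  fixes x :: "nat \<Rightarrow> 'a::{real_inner, complete_space}"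
  assumes S: "S \<noteq> {}" and fejer: "\<And>z. z \<in> S \<Longrightarrow> convergent (\<lambda>n. (norm (x n - z))\<^sup>2)"
    and hull: "\<And>z. (\<And>n. z \<in> closure (convex hull (x ` {n..}))) \<Longrightarrow> z \<in> S"
  shows "\<exists>z\<in>S. weakly_converges_to x z"
proof -
  define T where "T n = closure (convex hull (x ` {n..}))" for n
  obtain s where "s \<in> S" using S by blast
  then have "bounded (range x)" by (rule bounded_of_convergent_distance[OF fejer])
  then have bdd: "bounded (closure (convex hull (x ` X)))" for X
    by (intro bounded_closure bounded_convex_hull) (auto intro: bounded_subset)
  have limit_value: "\<phi> z = c" if "bounded_linear \<phi>" "(\<lambda>n. \<phi> (x n)) \<longlonglongrightarrow> c" "\<And>n. z \<in> T n"
    for \<phi> :: "'a \<Rightarrow> real" and z c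
  proof -
    have "\<bar>\<phi> z - c\<bar> \<le> e" if e: "0 < e" for e
    proof -
      obtain n where n: "\<And>k. k \<ge> n \<Longrightarrow> dist (\<phi> (x k)) c < e"
        using tendstoD[OF \<open>(\<lambda>n. \<phi> (x n)) \<longlonglongrightarrow> c\<close> e] by (auto simp: eventually_sequentially)
      have "z \<in> \<phi> -` {c - e..c + e}"
      proof (rule in_closed_convex_of_hull)
        show "z \<in> closure (convex hull (x ` {n..}))" using \<open>\<And>n. z \<in> T n\<close> by (simp add: T_def)
        show "x ` {n..} \<subseteq> \<phi> -` {c - e..c + e}"
        proof clarify
          fix k assume "n \<le> k"
          then show "x k \<in> \<phi> -` {c - e..c + e}" using n[of k] by (auto simp: dist_real_def)
        qed
        show "closed (\<phi> -` {c - e..c + e})"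
          using \<open>bounded_linear \<phi>\<close> by (intro continuous_closed_vimage) (auto intro: linear_continuous_at)
        show "convex (\<phi> -` {c - e..c + e})"
          using \<open>bounded_linear \<phi>\<close> by (intro convex_linear_vimage) (auto simp: bounded_linear.linear)
      qed
      then show ?thesis by auto
    qed
    then have "\<bar>\<phi> z - c\<bar> \<le> 0" by (rule field_le_epsilon) simp
    then show ?thesis by simp
  qed
  have unique: "z = z'" if z: "\<And>n. z \<in> T n" and z': "\<And>n. z' \<in> T n" for z z'
  proof -
    have "z \<in> S" "z' \<in> S" using hull z z' by (auto simp: T_def)
    then have "convergent (\<lambda>n. (1/2) * ((norm z)\<^sup>2 - (norm z')\<^sup>2 - ((norm (x n - z))\<^sup>2 - (norm (x n - z'))\<^sup>2)))"
      by (intro convergent_mult convergent_diff convergent_const fejer)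
    moreover have "(1/2) * ((norm z)\<^sup>2 - (norm z')\<^sup>2 - ((norm (x n - z))\<^sup>2 - (norm (x n - z'))\<^sup>2)) = inner (x n) (z - z')" for n
      by (simp add: power2_norm_eq_inner algebra_simps inner_commute)
    ultimately obtain c where "(\<lambda>n. inner (x n) (z - z')) \<longlonglongrightarrow> c" by (auto simp: convergent_def)
    then have "inner z (z - z') = c" "inner z' (z - z') = c"
      using limit_value[OF bounded_linear_inner_left] z z' by blast+
    then have "inner (z - z') (z - z') = 0" by (simp add: inner_diff_left)
    then show "z = z'" by simp
  qed
  have "\<exists>z. \<forall>n. z \<in> T n"
    unfolding T_def
    by (rule decreasing_convex_sets_meet)
      (auto intro!: bdd closure_mono hull_mono image_mono intro: convex_closure)
  then obtain z where z: "\<And>n. z \<in> T n" by blast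
  have upper: "\<forall>\<^sub>F n in sequentially. \<phi> (x n) < \<phi> z + e"
    if \<phi>: "bounded_linear \<phi>" and e: "0 < e" for \<phi> :: "'a \<Rightarrow> real" and e
  proof (rule ccontr)
    assume "\<not> (\<forall>\<^sub>F n in sequentially. \<phi> (x n) < \<phi> z + e)"
    then have freq: "\<exists>k\<ge>n. \<phi> z + e \<le> \<phi> (x k)" for n
      by (auto simp: eventually_sequentially not_less)
    define X where "X n = {k. n \<le> k \<and> \<phi> z + e \<le> \<phi> (x k)}" for n
    have "\<exists>w. \<forall>n. w \<in> closure (convex hull (x ` X n))"
    proof (rule decreasing_convex_sets_meet)
      fix n show "closure (convex hull (x ` X n)) \<noteq> {}" using freq[of n] by (auto simp: X_def)
    qed (auto intro!: bdd closure_mono hull_mono image_mono intro: convex_closure simp: X_def)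
    then obtain w where w: "\<And>n. w \<in> closure (convex hull (x ` X n))" by blast
    have "closure (convex hull (x ` X n)) \<subseteq> T n" for n
      unfolding T_def by (intro closure_mono hull_mono image_mono) (auto simp: X_def)
    then have "w = z" using unique w z by blast
    moreover have "w \<in> \<phi> -` {\<phi> z + e..}"
    proof (rule in_closed_convex_of_hull[OF w[of 0]])
      show "closed (\<phi> -` {\<phi> z + e..})"
        using \<phi> by (intro continuous_closed_vimage) (auto intro: linear_continuous_at)
      show "convex (\<phi> -` {\<phi> z + e..})"
        using \<phi> by (intro convex_linear_vimage) (auto simp: bounded_linear.linear)
    qed (auto simp: X_def)
    ultimately show False using e by simp
  qed
  have "(\<lambda>n. \<phi> (x n)) \<longlonglongrightarrow> \<phi> z" if \<phi>: "bounded_linear \<phi>" for \<phi> :: "'a \<Rightarrow> real"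
  proof (rule tendstoI)
    fix e :: real assume e: "0 < e"
    show "\<forall>\<^sub>F n in sequentially. dist (\<phi> (x n)) (\<phi> z) < e"
      using upper[OF \<phi> e] upper[OF bounded_linear_minus[OF \<phi>] e]
      by eventually_elim (auto simp: dist_real_def abs_less_iff)
  qed
  moreover have "z \<in> S" using hull z by (simp add: T_def)
  ultimately show ?thesis unfolding weakly_converges_to_def by blast
qed

section \<open>Inertial recursions\<close>

lemma convergent_of_contracted_difference:
  fixes a :: "nat \<Rightarrow> real"
  assumes \<alpha>: "0 \<le> \<alpha>" "\<alpha> < 1" and lim: "convergent (\<lambda>n. a (Suc n) - \<alpha> * a n)"
  shows "convergent a"
proof -
  obtain l where l: "(\<lambda>n. a (Suc n) - \<alpha> * a n) \<longlonglongrightarrow> l" using lim by (auto simp: convergent_def)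
  define m where "m = l / (1 - \<alpha>)"
  have lm: "l = (1 - \<alpha>) * m" using \<alpha> by (simp add: m_def)
  have "a \<longlonglongrightarrow> m"
  proof (rule tendstoI)
    fix e :: real assume e: "0 < e"
    define \<delta> where "\<delta> = (1 - \<alpha>) * (e / 2)"
    have \<delta>: "\<delta> > 0" using e \<alpha> by (simp add: \<delta>_def)
    obtain N where N: "\<And>n. n \<ge> N \<Longrightarrow> dist (a (Suc n) - \<alpha> * a n) l < \<delta>"
      using tendstoD[OF l \<delta>] by (auto simp: eventually_sequentially)
    define B where "B = \<bar>a N - m\<bar>"
    have bound: "\<bar>a (N + k) - m\<bar> \<le> \<alpha> ^ k * B + e / 2" for k
    proof (induction k)
      case 0
      then show ?case using e by (simp add: B_def)
    next
      case (Suc k)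
      have "a (Suc (N + k)) - m = (a (Suc (N + k)) - \<alpha> * a (N + k) - l) + \<alpha> * (a (N + k) - m)"
        by (simp add: lm algebra_simps)
      then have "\<bar>a (Suc (N + k)) - m\<bar> \<le> \<bar>a (Suc (N + k)) - \<alpha> * a (N + k) - l\<bar> + \<alpha> * \<bar>a (N + k) - m\<bar>"
        using abs_triangle_ineq \<alpha>(1) by (metis abs_mult abs_of_nonneg)
      also have "\<dots> \<le> \<delta> + \<alpha> * (\<alpha> ^ k * B + e / 2)"
        using N[of "N + k"] Suc \<alpha>(1) by (intro add_mono mult_left_mono) (auto simp: dist_real_def)
      also have "\<dots> = \<alpha> ^ Suc k * B + e / 2" by (simp add: \<delta>_def field_simps)
      finally show ?case by simp
    qed
    have "(\<lambda>k. \<alpha> ^ k * B) \<longlonglongrightarrow> 0 * B"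
      using \<alpha> by (intro tendsto_mult LIMSEQ_power_zero) auto
    then obtain k0 where k0: "\<And>k. k \<ge> k0 \<Longrightarrow> \<bar>\<alpha> ^ k * B\<bar> < e / 2"
      using e tendstoD[of "\<lambda>k. \<alpha> ^ k * B" 0 sequentially "e / 2"]
      by (auto simp: eventually_sequentially dist_real_def)
    show "\<forall>\<^sub>F n in sequentially. dist (a n) m < e"
      unfolding eventually_sequentially
    proof (intro exI allI impI)
      fix n assume "N + k0 \<le> n"
      then have "\<bar>a n - m\<bar> \<le> \<alpha> ^ (n - N) * B + e / 2" "\<bar>\<alpha> ^ (n - N) * B\<bar> < e / 2"
        using bound[of "n - N"] k0[of "n - N"] by auto
      then show "dist (a n) m < e" unfolding dist_real_def by linarith
    qed
  qed
  then show ?thesis by (auto simp: convergent_def)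
qed

text \<open>
  The energy \<open>a (n + 1) - \<alpha> a n + 2 \<alpha> c n\<close> changes in one step by at most \<open>\<epsilon> n - (1 - 3 \<alpha>) c (n + 1)\<close>. Subtracting
  the partial sums of \<open>\<epsilon>\<close> gives a decreasing sequence \<open>\<nu>\<close>; it bounds \<open>a\<close>, is therefore bounded below, and so
  converges. Then \<open>c\<close> tends to \<open>0\<close> and \<open>a (n + 1) - \<alpha> a n\<close> converges.
\<close>

lemma inertial_recursion:
  fixes a c \<epsilon> :: "nat \<Rightarrow> real"
  assumes \<alpha>: "0 \<le> \<alpha>" "\<alpha> < 1 / 3" and a: "\<And>n. 0 \<le> a n" and c: "\<And>n. 0 \<le> c n"
    and \<epsilon>: "\<And>n. 0 \<le> \<epsilon> n" "summable \<epsilon>"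
    and rec: "\<And>n. a (n + 2) - (1 + \<alpha>) * a (n + 1) + \<alpha> * a n
      \<le> - (1 - \<alpha>) * c (n + 1) + 2 * \<alpha> * c n + \<epsilon> n"
  shows "convergent a" "c \<longlonglongrightarrow> 0"
proof -
  define \<nu> where "\<nu> n = a (n + 1) - \<alpha> * a n + 2 * \<alpha> * c n - (\<Sum>i<n. \<epsilon> i)" for n
  have drop: "(1 - 3 * \<alpha>) * c (n + 1) \<le> \<nu> n - \<nu> (Suc n)" for n
    using rec[of n] by (simp add: \<nu>_def algebra_simps)
  have "\<nu> (Suc n) \<le> \<nu> n" for n
  proof -
    have "0 \<le> (1 - 3 * \<alpha>) * c (n + 1)" using c \<alpha> by (intro mult_nonneg_nonneg) auto
    then show ?thesis using drop[of n] by linarith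
  qed
  then have dec: "decseq \<nu>" by (simp add: decseq_SucI)
  have part: "(\<Sum>i<n. \<epsilon> i) \<le> suminf \<epsilon>" for n
    using \<epsilon> by (intro sum_le_suminf) auto
  \<comment> \<open>the larger of \<open>a 0\<close> and the fixed point of the recursive bound \<open>a (n + 1) \<le> \<alpha> a n + (\<nu> 0 + suminf \<epsilon>)\<close>\<close>
  define A where "A = max (a 0) ((\<nu> 0 + suminf \<epsilon>) / (1 - \<alpha>))"
  have a_le: "a n \<le> A" for n
  proof (induction n)
    case 0
    then show ?case by (simp add: A_def)
  next
    case (Suc n)
    have "\<nu> n \<le> \<nu> 0" using dec by (simp add: decseqD)
    moreover have "a (Suc n) = \<nu> n + \<alpha> * a n - 2 * (\<alpha> * c n) + (\<Sum>i<n. \<epsilon> i)" by (simp add: \<nu>_def)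
    ultimately have "a (Suc n) \<le> \<alpha> * a n + (\<nu> 0 + suminf \<epsilon>)"
      using part[of n] mult_nonneg_nonneg[OF \<alpha>(1) c[of n]] by linarith
    also have "\<alpha> * a n \<le> \<alpha> * A" using Suc \<alpha> by (intro mult_left_mono) auto
    also have "(\<nu> 0 + suminf \<epsilon>) / (1 - \<alpha>) \<le> A" by (simp add: A_def)
    then have "\<nu> 0 + suminf \<epsilon> \<le> A * (1 - \<alpha>)" using \<alpha> by (subst (asm) pos_divide_le_eq) auto
    finally show ?case by (simp add: algebra_simps)
  qed
  have "- \<alpha> * A - suminf \<epsilon> \<le> \<nu> n" for n
  proof -
    have "\<alpha> * a n \<le> \<alpha> * A" using a_le \<alpha> by (intro mult_left_mono) auto
    then show ?thesis
      using part[of n] a[of "n + 1"] mult_nonneg_nonneg[OF \<alpha>(1) c[of n]] by (simp add: \<nu>_def)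
  qed
  then obtain l where l: "\<nu> \<longlonglongrightarrow> l" using decseq_convergent[OF dec] by blast
  have "(\<lambda>n. (\<nu> n - \<nu> (Suc n)) / (1 - 3 * \<alpha>)) \<longlonglongrightarrow> (l - l) / (1 - 3 * \<alpha>)"
    using \<alpha> l by (intro tendsto_intros LIMSEQ_Suc) auto
  then have "(\<lambda>n. (\<nu> n - \<nu> (Suc n)) / (1 - 3 * \<alpha>)) \<longlonglongrightarrow> 0" by simp
  then have "(\<lambda>n. c (n + 1)) \<longlonglongrightarrow> 0"
    using c drop \<alpha> by (intro tendsto_sandwich[of "\<lambda>_. 0" "\<lambda>n. c (n + 1)" _ "\<lambda>n. (\<nu> n - \<nu> (Suc n)) / (1 - 3 * \<alpha>)"] always_eventually allI)
      (auto simp: pos_le_divide_eq mult.commute)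
  then show c0: "c \<longlonglongrightarrow> 0" by (rule LIMSEQ_offset)
  have "(\<lambda>n. \<nu> n - 2 * \<alpha> * c n + (\<Sum>i<n. \<epsilon> i)) \<longlonglongrightarrow> l - 2 * \<alpha> * 0 + suminf \<epsilon>"
    using l c0 \<epsilon> by (intro tendsto_intros summable_LIMSEQ)
  then have "convergent (\<lambda>n. a (Suc n) - \<alpha> * a n)"
    by (auto simp: convergent_def \<nu>_def)
  moreover have "\<alpha> < 1" using \<alpha> by simp
  ultimately show "convergent a" by (metis convergent_of_contracted_difference \<alpha>(1))
qed

text \<open>
  The two sides differ by \<open>\<alpha> \<parallel>(c - b) - (b - w)\<parallel>\<^sup>2\<close>. Here \<open>w\<close>, \<open>b\<close>, \<open>c\<close> are three consecutive iterates.
\<close>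

lemma inertial_three_point:
  fixes b c u w :: "'a::real_inner"
  assumes "0 \<le> \<alpha>"
  shows "(norm (c - u))\<^sup>2 - (1 + \<alpha>) * (norm (b - u))\<^sup>2 + \<alpha> * (norm (w - u))\<^sup>2
      \<le> - (1 - \<alpha>) * (norm (c - b))\<^sup>2 + 2 * \<alpha> * (norm (b - w))\<^sup>2
        + 2 * inner (c - (b + \<alpha> *\<^sub>R (b - w))) (c - u)"
proof -
  have "2 * inner (c - (b + \<alpha> *\<^sub>R (b - w))) (c - u) - (1 - \<alpha>) * (norm (c - b))\<^sup>2 + 2 * \<alpha> * (norm (b - w))\<^sup>2
      - ((norm (c - u))\<^sup>2 - (1 + \<alpha>) * (norm (b - u))\<^sup>2 + \<alpha> * (norm (w - u))\<^sup>2)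
      = \<alpha> * (norm ((c - b) - (b - w)))\<^sup>2"
    by (simp add: power2_norm_eq_inner algebra_simps inner_commute)
  moreover have "0 \<le> \<alpha> * (norm ((c - b) - (b - w)))\<^sup>2" using assms by simp
  ultimately show ?thesis by linarith
qed

section \<open>Convergence of the inertial proximal scheme\<close>

text \<open>
  The terms of the penalty series, which must be finite, serve as the error sequence. At \<open>q = 2p/\<beta>\<^sub>n\<close> the Fitzpatrick
  transform is at least \<open>\<langle>q, v\<rangle> + f(v, u)\<close>, and the support function is at most \<open>\<langle>q, u\<rangle>\<close> since \<open>p\<close> is normal to the
  solution set at \<open>u\<close>. The choice \<open>v = u\<close> shows that the terms are nonnegative.
\<close>

lemma penalty_bounds:
  assumes C: "u \<in> K" "u \<in> equilibrium_solutions K f" "f u u = 0"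
    and p: "p \<in> normal_cone (equilibrium_solutions K f) u"
    and pos: "\<And>n. n \<ge> 1 \<Longrightarrow> lam n > 0" "\<And>n. n \<ge> 1 \<Longrightarrow> bet n > (0::real)"
    and fin: "penalty_series K f lam bet u p < \<infinity>"
  obtains \<epsilon> :: "nat \<Rightarrow> real" where "summable \<epsilon>" "\<And>n. 0 \<le> \<epsilon> n"
    "\<And>n v. v \<in> K \<Longrightarrow> lam (Suc n) * (bet (Suc n) * f v u + 2 * inner p (v - u)) \<le> \<epsilon> n"
proof -
  define q where "q n = (2 / bet (Suc n)) *\<^sub>R p" for n
  define T where "T n = ereal (lam (Suc n) * bet (Suc n)) *
    (fitzpatrick_transform K f u (q n) - support_function (equilibrium_solutions K f) (q n))" for n
  have pen: "penalty_series K f lam bet u p = (\<Sum>n. T n)"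
    by (simp add: penalty_series_def T_def q_def Let_def)
  have T_ge: "ereal (lam (Suc n) * (bet (Suc n) * f v u + 2 * inner p (v - u))) \<le> T n" if v: "v \<in> K" for n v
  proof -
    have l: "lam (Suc n) > 0" and b: "bet (Suc n) > 0" using pos by auto
    have "support_function (equilibrium_solutions K f) (q n) \<le> ereal (inner (q n) u)"
      unfolding support_function_def
    proof (rule SUP_least)
      fix y assume "y \<in> equilibrium_solutions K f"
      then have "inner p (y - u) \<le> 0" using p C(2) by (auto simp: normal_cone_def)
      then have "inner (q n) (y - u) \<le> 0" using b by (simp add: q_def divide_nonpos_pos)
      then show "ereal (inner (q n) y) \<le> ereal (inner (q n) u)" by (simp add: inner_diff_right)
    qed
    moreover have "ereal (inner (q n) v + f v u) \<le> fitzpatrick_transform K f u (q n)"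
      unfolding fitzpatrick_transform_def using v by (rule SUP_upper)
    ultimately have "ereal (inner (q n) v + f v u) - ereal (inner (q n) u)
        \<le> fitzpatrick_transform K f u (q n) - support_function (equilibrium_solutions K f) (q n)"
      by (rule ereal_minus_mono[rotated])
    then have "ereal (lam (Suc n) * bet (Suc n)) * (ereal (inner (q n) v + f v u) - ereal (inner (q n) u)) \<le> T n"
      unfolding T_def using l b by (intro ereal_mult_left_mono) auto
    moreover have "lam (Suc n) * bet (Suc n) * ((inner (q n) v + f v u) - inner (q n) u)
        = lam (Suc n) * (bet (Suc n) * f v u + 2 * inner p (v - u))"
      using b by (simp add: q_def inner_diff_right field_simps)
    ultimately show ?thesis by simp
  qed
  have T0: "0 \<le> T n" for n using T_ge[OF C(1), of n] C(3) by (simp add: zero_ereal_def)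
  moreover have "(\<Sum>n. T n) \<noteq> \<infinity>" using fin pen by simp
  ultimately obtain \<epsilon> where \<epsilon>: "T = (\<lambda>n. ereal (\<epsilon> n))" using suminf_PInfty_fun by blast
  have "0 \<le> \<epsilon> n" for n using T0[of n] \<epsilon> by simp
  moreover have "summable \<epsilon>"
    using \<open>\<And>n. 0 \<le> \<epsilon> n\<close> \<open>(\<Sum>n. T n) \<noteq> \<infinity>\<close> unfolding \<epsilon> by (intro summable_ereal)
  ultimately show ?thesis using that[of \<epsilon>] T_ge unfolding \<epsilon> by simp
qed

theorem theorem1:
  fixes K :: "'a::{real_inner, complete_space} set"
    and f g :: "'a \<Rightarrow> 'a \<Rightarrow> real"
    and lam bet :: "nat \<Rightarrow> real"
    and \<alpha> :: real
    and x :: "nat \<Rightarrow> 'a"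
  assumes K: "K \<noteq> {}" "closed K" "convex K"
    and f: "monotone_bifunction K f" "upper_hemicontinuous K f" "equilibrium_bifunction K f"
    and g: "monotone_bifunction K g" "upper_hemicontinuous K g" "equilibrium_bifunction K g"
    and S_nonempty: "bilevel_solutions K f g \<noteq> {}"
    and subdifferential_nonempty:
      "\<And>y. y \<in> K \<Longrightarrow> subdifferential (extend_by_infinity K (g y)) y \<noteq> {}"
    and K_Sf: "K \<inter> equilibrium_solutions K f \<noteq> {}"
    and qualification:
      "subspace {t *\<^sub>R (k - s) | t k s. 0 \<le> t \<and> k \<in> K \<and> s \<in> equilibrium_solutions K f}"
      "closed {t *\<^sub>R (k - s) | t k s. 0 \<le> t \<and> k \<in> K \<and> s \<in> equilibrium_solutions K f}"
    and lam_pos: "\<And>n. n \<ge> 1 \<Longrightarrow> lam n > 0"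
    and bet_pos: "\<And>n. n \<ge> 1 \<Longrightarrow> bet n > 0"
    and x_in: "\<And>n. x n \<in> K"
    and x_step: "\<And>n y. n \<ge> 1 \<Longrightarrow> y \<in> K \<Longrightarrow>
      bet n * f (x (Suc n)) y + g (x (Suc n)) y
        + 1 / lam n * inner (x (Suc n) - (x n + \<alpha> *\<^sub>R (x n - x (n - 1)))) (y - x (Suc n)) \<ge> 0"
    and series: "\<And>u p. u \<in> equilibrium_solutions K f \<Longrightarrow>
      p \<in> normal_cone (equilibrium_solutions K f) u \<Longrightarrow> penalty_series K f lam bet u p < \<infinity>"
    and alpha: "0 \<le> \<alpha>" "\<alpha> < 1 / 3"
    and lam_liminf: "liminf (\<lambda>n. ereal (lam n)) > 0"
    and bet_lim: "filterlim bet at_top sequentially"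
  shows "\<exists>xbar \<in> bilevel_solutions K f g. weakly_converges_to x xbar"
proof -
  let ?C = "equilibrium_solutions K f"
  let ?S = "bilevel_solutions K f g"
  have C: "closed ?C" "convex ?C" by (rule equilibrium_solutions_closed_convex[OF K(2,3) f])+
  have CK: "?C \<subseteq> K" by (auto simp: equilibrium_solutions_def)
  have f_mono: "f a b \<le> - f b a" if "a \<in> K" "b \<in> K" for a b
    using f(1) that unfolding monotone_bifunction_def by (smt (verit))
  have g_mono: "g a b \<le> - g b a" if "a \<in> K" "b \<in> K" for a b
    using g(1) that unfolding monotone_bifunction_def by (smt (verit))
  have f_C: "f a u \<le> 0" if "u \<in> ?C" "a \<in> K" for a u
  proof -
    have "0 \<le> f u a" using that by (simp add: equilibrium_solutions_def)
    moreover have "f a u \<le> - f u a" using that CK by (intro f_mono) auto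
    ultimately show ?thesis by linarith
  qed
  \<comment> \<open>indices start at \<open>0\<close>: step \<open>n + 1\<close> of the scheme produces \<open>x (n + 2)\<close>\<close>
  define w where "w n = x (n + 2) - (x (n + 1) + \<alpha> *\<^sub>R (x (n + 1) - x n))" for n
  define r where "r n y = 1 / lam (Suc n) * inner (w n) (y - x (n + 2))" for n y
  have step: "0 \<le> bet (Suc n) * f (x (n + 2)) y + g (x (n + 2)) y + r n y" if "y \<in> K" for n y
    using x_step[of "Suc n" y] that by (simp add: r_def w_def)
  have energy: "convergent (\<lambda>n. (norm (x n - u))\<^sup>2)" "(\<lambda>n. (norm (x (n + 1) - x n))\<^sup>2) \<longlonglongrightarrow> 0"
    if u: "u \<in> ?S" for u
  proof -
    have uC: "u \<in> ?C" and g_ge: "\<And>y. y \<in> ?C \<Longrightarrow> 0 \<le> g u y"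
      using u by (auto simp: bilevel_solutions_def)
    have uK: "u \<in> K" using uC CK by blast
    interpret convex_constraint_pair K ?C "g u" u
      "{t *\<^sub>R (k - s) | t k s. 0 \<le> t \<and> k \<in> K \<and> s \<in> ?C}"
    proof
      show "convex_on K (g u)" "lower_semicontinuous_on K (g u)" "g u u = 0"
        using g(3) uK by (auto simp: equilibrium_bifunction_def)
      show "0 \<le> g u k" if "k \<in> ?C" for k using that by (rule g_ge)
    qed (fact K(2) K(3) C uK uC qualification | rule refl)+
    obtain p where p: "\<And>k s. k \<in> K \<Longrightarrow> s \<in> ?C \<Longrightarrow> 0 \<le> g u k + inner p (k - s)"
      using multiplier_exists by blast
    have "inner p (s - u) \<le> 0" if "s \<in> ?C" for s
    proof -
      have "0 \<le> inner p (u - s)" using p[OF uK that] g(3) uK by (simp add: equilibrium_bifunction_def)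
      then show ?thesis by (simp add: inner_diff_right)
    qed
    then have pN: "p \<in> normal_cone ?C u" using uC by (simp add: normal_cone_def)
    have "f u u = 0" using f(3) uK by (simp add: equilibrium_bifunction_def)
    then obtain \<epsilon> :: "nat \<Rightarrow> real" where \<epsilon>: "summable \<epsilon>" "\<And>n. 0 \<le> \<epsilon> n"
      and pen: "\<And>n v. v \<in> K \<Longrightarrow> lam (Suc n) * (bet (Suc n) * f v u + 2 * inner p (v - u)) \<le> \<epsilon> n"
      using penalty_bounds[OF uK uC _ pN lam_pos bet_pos series[OF uC pN]] by metis
    have descent: "2 * inner (w n) (x (n + 2) - u) \<le> \<epsilon> n" for n
    proof -
      let ?X = "x (n + 2)"
      have l: "lam (Suc n) > 0" and b: "bet (Suc n) > 0" using lam_pos bet_pos by auto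
      have "g ?X u \<le> - g u ?X" using x_in uK by (rule g_mono)
      also have "\<dots> \<le> inner p (?X - u)" using p[OF x_in uC, of "n + 2"] by linarith
      finally have gX: "g ?X u \<le> inner p (?X - u)" .
      have bf: "bet (Suc n) * f ?X u \<le> 0" using f_C[OF uC x_in] b by (simp add: mult_nonneg_nonpos)
      \<comment> \<open>one of the two copies of the nonpositive term \<open>\<beta> f(x, u)\<close> is dropped, to match the factor \<open>2p\<close>\<close>
      have "0 \<le> 2 * (bet (Suc n) * f ?X u + g ?X u + r n u)" using step[OF uK, of n] by simp
      also have "\<dots> \<le> (bet (Suc n) * f ?X u + 2 * inner p (?X - u)) + 2 * r n u"
        using gX bf by argo
      finally have "0 \<le> lam (Suc n) * ((bet (Suc n) * f ?X u + 2 * inner p (?X - u)) + 2 * r n u)"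
        using l by simp
      also have "\<dots> = lam (Suc n) * (bet (Suc n) * f ?X u + 2 * inner p (?X - u))
          - 2 * inner (w n) (?X - u)"
        using l by (simp add: r_def inner_diff_right field_simps)
      finally show ?thesis using pen[OF x_in, of n "n + 2"] by linarith
    qed
    have rec: "(norm (x (n + 2) - u))\<^sup>2 - (1 + \<alpha>) * (norm (x (n + 1) - u))\<^sup>2 + \<alpha> * (norm (x n - u))\<^sup>2
        \<le> - (1 - \<alpha>) * (norm (x (n + 1 + 1) - x (n + 1)))\<^sup>2 + 2 * \<alpha> * (norm (x (n + 1) - x n))\<^sup>2 + \<epsilon> n" for n
      using inertial_three_point[OF alpha(1), of "x (n + 2)" u "x (n + 1)" "x n"] descent[of n]
      by (simp add: w_def)
    show "convergent (\<lambda>n. (norm (x n - u))\<^sup>2)" "(\<lambda>n. (norm (x (n + 1) - x n))\<^sup>2) \<longlonglongrightarrow> 0"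
      by (rule inertial_recursion[OF alpha _ _ \<epsilon>(2,1) rec]; simp)+
  qed
  obtain u where u: "u \<in> ?S" using S_nonempty by blast
  obtain B where B: "\<And>n. norm (x n) \<le> B"
    using bounded_of_convergent_distance[OF energy(1)[OF u]] by (auto simp: bounded_iff)
  have "(\<lambda>n. sqrt ((norm (x (n + 1) - x n))\<^sup>2)) \<longlonglongrightarrow> sqrt 0"
    by (intro tendsto_real_sqrt energy(2)[OF u])
  then have diff: "(\<lambda>n. x (n + 1) - x n) \<longlonglongrightarrow> 0" by (simp add: tendsto_norm_zero_iff)
  then have "(\<lambda>n. (x (n + 1 + 1) - x (n + 1)) - \<alpha> *\<^sub>R (x (n + 1) - x n)) \<longlonglongrightarrow> 0 - \<alpha> *\<^sub>R 0"
    using LIMSEQ_ignore_initial_segment[OF diff, of 1] by (intro tendsto_intros)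
  moreover have "w = (\<lambda>n. (x (n + 1 + 1) - x (n + 1)) - \<alpha> *\<^sub>R (x (n + 1) - x n))"
    by (auto simp: w_def)
  ultimately have w0: "w \<longlonglongrightarrow> 0" by simp
  have r0: "(\<lambda>n. r n y) \<longlonglongrightarrow> 0" for y
  proof -
    obtain l where l: "0 < ereal l" "ereal l < liminf (\<lambda>n. ereal (lam n))"
      using ereal_dense2[OF lam_liminf] by blast
    have "\<forall>\<^sub>F n in sequentially. l < lam n" using less_LiminfD[OF l(2)] by simp
    then have "\<forall>\<^sub>F n in sequentially. l < lam (Suc n)"
      by (rule eventually_sequentially_Suc[of "\<lambda>n. l < lam n", THEN iffD2])
    then have "\<forall>\<^sub>F n in sequentially. norm (r n y) \<le> norm (w n) * ((norm y + B) / l)"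
    proof eventually_elim
      case (elim n)
      have l0: "0 < l" using l(1) by simp
      have "norm (r n y) = \<bar>inner (w n) (y - x (n + 2))\<bar> / lam (Suc n)"
        using elim l0 by (simp add: r_def abs_mult)
      also have "\<dots> \<le> (norm (w n) * (norm y + B)) / l"
      proof (rule frac_le)
        have "\<bar>inner (w n) (y - x (n + 2))\<bar> \<le> norm (w n) * norm (y - x (n + 2))"
          by (rule Cauchy_Schwarz_ineq2)
        also have "norm (y - x (n + 2)) \<le> norm y + B"
          using norm_triangle_ineq4[of y "x (n + 2)"] B[of "n + 2"] by linarith
        finally show "\<bar>inner (w n) (y - x (n + 2))\<bar> \<le> norm (w n) * (norm y + B)"
          by (simp add: mult_left_mono)
      next
        show "0 \<le> norm (w n) * (norm y + B)"
          using order_trans[OF norm_ge_zero B[of 0]] by simp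
      qed (use elim l0 in auto)
      finally show ?case by simp
    qed
    moreover have "(\<lambda>n. norm (w n) * ((norm y + B) / l)) \<longlonglongrightarrow> 0"
      using w0 by (intro tendsto_mult_left_zero tendsto_norm_zero)
    ultimately show ?thesis by (rule Lim_null_comparison)
  qed
  have f_asym: "\<forall>\<^sub>F n in sequentially. f y (x n) \<le> e" if y: "y \<in> K" and e: "0 < e" for y e
  proof -
    obtain q where q: "q \<in> subdifferential (extend_by_infinity K (g y)) y"
      using subdifferential_nonempty[OF y] by blast
    have g_ge: "inner q (v - y) \<le> g y v" if "v \<in> K" for v
    proof -
      have "extend_by_infinity K (g y) y + ereal (inner q (v - y)) \<le> extend_by_infinity K (g y) v"
        using q by (simp add: subdifferential_def)
      then show ?thesis using that y g(3) by (simp add: extend_by_infinity_def equilibrium_bifunction_def)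
    qed
    \<comment> \<open>the subgradient bounds \<open>g (x n) y\<close> from above along the bounded sequence\<close>
    define G where "G = norm q * (B + norm y)"
    have g_le: "g (x n) y \<le> G" for n
    proof -
      have "g (x n) y \<le> - g y (x n)" using x_in y by (rule g_mono)
      also have "\<dots> \<le> \<bar>inner q (x n - y)\<bar>" using g_ge[OF x_in] by (smt (verit))
      also have "\<dots> \<le> norm q * norm (x n - y)" by (rule Cauchy_Schwarz_ineq2)
      also have "norm (x n - y) \<le> B + norm y" using norm_triangle_ineq4[of "x n" y] B[of n] by linarith
      finally show ?thesis by (simp add: G_def mult_left_mono)
    qed
    have "\<forall>\<^sub>F n in sequentially. \<bar>r n y\<bar> < 1" using tendstoD[OF r0, of 1 y] by simp
    moreover have "\<forall>\<^sub>F n in sequentially. (G + 1) / e \<le> bet n"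
      using bet_lim by (simp add: filterlim_at_top)
    then have "\<forall>\<^sub>F n in sequentially. (G + 1) / e \<le> bet (Suc n)"
      by (rule eventually_sequentially_Suc[of "\<lambda>n. (G + 1) / e \<le> bet n", THEN iffD2])
    ultimately have "\<forall>\<^sub>F n in sequentially. f y (x (n + 2)) \<le> e"
    proof eventually_elim
      case (elim n)
      have b: "bet (Suc n) > 0" using bet_pos by simp
      have "- f (x (n + 2)) y * bet (Suc n) \<le> G + 1"
        using step[OF y, of n] g_le[of "n + 2"] elim(1) by (simp add: mult.commute)
      also have "G + 1 \<le> e * bet (Suc n)" using elim(2) e by (simp add: pos_divide_le_eq mult.commute)
      finally have "- f (x (n + 2)) y \<le> e" using b by (rule mult_right_le_imp_le)
      moreover have "f y (x (n + 2)) \<le> - f (x (n + 2)) y" using y x_in by (rule f_mono)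
      ultimately show ?case by linarith
    qed
    then show ?thesis by (rule eventually_sequentially_seg[of "\<lambda>n. f y (x n) \<le> e" 2, THEN iffD1])
  qed
  have g_asym: "\<forall>\<^sub>F n in sequentially. g y (x n) \<le> e" if y: "y \<in> ?C" and e: "0 < e" for y e
  proof -
    have yK: "y \<in> K" using y CK by blast
    have "\<forall>\<^sub>F n in sequentially. \<bar>r n y\<bar> < e" using tendstoD[OF r0 e, of y] by simp
    then have "\<forall>\<^sub>F n in sequentially. g y (x (n + 2)) \<le> e"
    proof eventually_elim
      case (elim n)
      have "bet (Suc n) * f (x (n + 2)) y \<le> 0"
        using bet_pos[of "Suc n"] f_C[OF y x_in] by (simp add: mult_nonneg_nonpos)
      moreover have "g y (x (n + 2)) \<le> - g (x (n + 2)) y" using yK x_in by (rule g_mono)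
      ultimately show ?case using step[OF yK, of n] elim by linarith
    qed
    then show ?thesis by (rule eventually_sequentially_seg[of "\<lambda>n. g y (x n) \<le> e" 2, THEN iffD1])
  qed
  have limit_le: "h z \<le> 0"
    if hull: "\<And>n. z \<in> closure (convex hull (x ` {n..}))"
      and h: "convex_on K h" "lower_semicontinuous_on K h"
      and ev: "\<And>e. 0 < e \<Longrightarrow> \<forall>\<^sub>F n in sequentially. h (x n) \<le> e" for h z
  proof (rule field_le_epsilon)
    fix e :: real assume "0 < e"
    then obtain N where N: "\<And>n. n \<ge> N \<Longrightarrow> h (x n) \<le> e"
      using ev by (auto simp: eventually_sequentially)
    have "z \<in> {k \<in> K. h k \<le> e}"
      by (rule in_closed_convex_of_hull[OF hull[of N]])
        (use N x_in K h in \<open>auto intro: closed_sublevel convex_sublevel\<close>)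
    then show "h z \<le> 0 + e" by simp
  qed
  show ?thesis
  proof (rule weak_convergence_from_tail_hulls[OF S_nonempty energy(1)])
    fix z assume hull: "\<And>n. z \<in> closure (convex hull (x ` {n..}))"
    have zK: "z \<in> K"
      by (rule in_closed_convex_of_hull[OF hull[of 0]]) (use x_in K in auto)
    have "f y z \<le> 0" if "y \<in> K" for y
      using limit_le[OF hull, of "f y"] f_asym that f(3) by (simp add: equilibrium_bifunction_def)
    then have zC: "z \<in> ?C" unfolding equilibrium_solutions_dual[OF K(3) f] using zK by blast
    have "g y z \<le> 0" if "y \<in> ?C" for y
    proof (rule limit_le[OF hull])
      have "y \<in> K" using that CK by blast
      then show "convex_on K (g y)" "lower_semicontinuous_on K (g y)"
        using g(3) by (auto simp: equilibrium_bifunction_def)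
    qed (rule g_asym[OF that])
    then have "0 \<le> g z y" if "y \<in> ?C" for y
      using minty[OF g(2,3) C(2) CK zC _ that] by blast
    with zC show "z \<in> ?S" by (simp add: bilevel_solutions_def)
  qed
qed

end
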